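(* Let $n,r\ge1$ and $0\le a\le 2n$ be integers with $n$ odd. There is no circulant Hadamard matrix $X_C$ of order $4rn$ generated by a sequence $$X=(Y_1,-Y_2,\dots,Y_{2r-1},-Y_{2r})\in\mathcal{G}_{2n}(a)\times\mathcal{G}_{2n}(2n-a)\times\cdots\times\mathcal{G}_{2n}(a)\times\mathcal{G}_{2n}(2n-a)\subset\mathcal{G}_{4rn}(2rn),$$ with $Y_i\in\mathcal{G}_{2n}(a)$ for all $i=1,\dots,2r$, if (1) $nr$ is odd and $\sum_{i=1}^{2r}\left(-\tfrac12\omega(-Y_iY_{i+1})+2a\right)$ is even, or (2) $nr$ is even and $\sum_{i=1}^{2r}\left(-\tfrac12\omega(-Y_iY_{i+1})+2a\right)$ is odd. Here $Y_{2r+1}=Y_1$.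
   Context: $\mathbb{Z}_2=\{+,-\}=\{1,-1\}$ under multiplication, and $\mathbb{Z}_2^m$ is the group of $\pm1$ sequences of length $m$ under componentwise multiplication; $-Y$ is the sequence with all signs changed. $\omega(X)$ is the number of entries of $X\in\mathbb{Z}_2^m$ equal to $+$, and $\mathcal{G}_m(k)=\{X\in\mathbb{Z}_2^m:\omega(X)=k\}$. Tuples of sequences denote concatenation. $C$ is the cyclic shift $C(x_0,\dots,x_{m-1})=(x_1,\dots,x_{m-1},x_0)$ and $X_C=\{C^i(X):0\le i<m\}$. $X_C$ is a circulant Hadamard matrix if the $m\times m$ circulant matrix whose rows are the cyclic shifts $C^i(X)$, $0\le i<m$, is a Hadamard matrix, i.e. a $\pm1$ matrix $H$ with $HH^t=mI_m$. *)

theory Defs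
  imports Main "Jordan_Normal_Form.Matrix"
begin

text \<open>Sign sequences are integer lists with entries \<open>1\<close> and \<open>-1\<close>. Entries are indexed from \<open>0\<close>;
  concatenation is list append, and the cyclic shift is \<^const>\<open>rotate1\<close>, whose \<open>i\<close>-th iterate
  is \<^term>\<open>rotate i\<close>.\<close>

definition sign_seqs :: "nat \<Rightarrow> int list set" where
  "sign_seqs m = {X. length X = m \<and> set X \<subseteq> {1, -1}}"

definition seq_weight :: "int list \<Rightarrow> nat" where
  "seq_weight X = count_list X 1"

definition sign_seqs_weight :: "nat \<Rightarrow> nat \<Rightarrow> int list set" where
  "sign_seqs_weight m k = {X \<in> sign_seqs m. seq_weight X = k}"

definition seq_neg :: "int list \<Rightarrow> int list" where
  "seq_neg X = map uminus X"

definition seq_mult :: "int list \<Rightarrow> int list \<Rightarrow> int list" where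
  "seq_mult X Y = map2 (*) X Y"

definition circulant_mat :: "int list \<Rightarrow> int mat" where
  "circulant_mat X = mat_of_rows_list (length X) (map (\<lambda>i. rotate i X) [0..<length X])"

definition hadamard_mat :: "nat \<Rightarrow> int mat \<Rightarrow> bool" where
  "hadamard_mat m H \<longleftrightarrow> H \<in> carrier_mat m m \<and> elements_mat H \<subseteq> {1, -1} \<and>
     H * transpose_mat H = int m \<cdot>\<^sub>m 1\<^sub>m m"

text \<open>The sequence \<open>(Y\<^sub>1, -Y\<^sub>2, Y\<^sub>3, -Y\<^sub>4, \<dots>, Y\<^bsub>2r-1\<^esub>, -Y\<^bsub>2r\<^esub>)\<close>; blocks are indexed from \<open>1\<close>.\<close>

definition alternating_concat :: "nat \<Rightarrow> (nat \<Rightarrow> int list) \<Rightarrow> int list" where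
  "alternating_concat r Y = concat (map (\<lambda>i. if odd i then Y i else seq_neg (Y i)) [1..<2*r+1])"

text \<open>The summands involve a factor \<open>1/2\<close>, so the sum is formed in the rationals. A rational
  is even or odd only if it is an integer.\<close>

definition weight_sum :: "nat \<Rightarrow> nat \<Rightarrow> (nat \<Rightarrow> int list) \<Rightarrow> rat" where
  "weight_sum r a Y =
     (\<Sum>i = 1..2*r. - (1/2) * of_nat (seq_weight (seq_neg (seq_mult (Y i) (Y (i + 1))))) + 2 * of_nat a)"

definition rat_even :: "rat \<Rightarrow> bool" where
  "rat_even q \<longleftrightarrow> (\<exists>k::int. even k \<and> q = of_int k)"

definition rat_odd :: "rat \<Rightarrow> bool" where
  "rat_odd q \<longleftrightarrow> (\<exists>k::int. odd k \<and> q = of_int k)"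

end

theory Submission
  imports Defs
begin

text \<open>Shifting \<open>X\<close> by one block, i.e. by \<open>2n\<close> places, pairs each block with the next one of opposite
  sign, so the product of \<open>X\<close> with its shift is the concatenation of the \<open>-Y\<^sub>iY\<^bsub>i+1\<^esub>\<close>. Orthogonality
  of these two rows forces exactly half of the \<open>4rn\<close> entries to be \<open>+\<close>, so the sum in the theorem
  equals \<open>4ar - rn\<close>, which has the parity of \<open>rn\<close>.\<close>

lemma seq_neg_sign_seqs: "seq_neg X \<in> sign_seqs m" if "X \<in> sign_seqs m"
  using that by (auto simp: sign_seqs_def seq_neg_def)

lemma seq_mult_sign_seqs: "seq_mult X Y \<in> sign_seqs m" if "X \<in> sign_seqs m" "Y \<in> sign_seqs m"
proof -
  have "x * y \<in> {1, -1}" if "(x, y) \<in> set (zip X Y)" for x y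
    using set_zip_leftD[OF that] set_zip_rightD[OF that]
      \<open>X \<in> sign_seqs m\<close> \<open>Y \<in> sign_seqs m\<close> by (fastforce simp: sign_seqs_def)
  with that show ?thesis
    by (auto simp: sign_seqs_def seq_mult_def)
qed

lemma seq_mult_append:
  "length A = length B \<Longrightarrow> seq_mult (A @ C) (B @ D) = seq_mult A B @ seq_mult C D"
  by (simp add: seq_mult_def)

lemma seq_mult_concat:
  assumes "\<And>i. i \<in> set xs \<Longrightarrow> length (f i) = length (g i)"
  shows "seq_mult (concat (map f xs)) (concat (map g xs)) =
    concat (map (\<lambda>i. seq_mult (f i) (g i)) xs)"
  using assms by (induction xs) (simp_all add: seq_mult_append, simp add: seq_mult_def)

lemma seq_mult_neg_left: "seq_mult (seq_neg A) B = seq_neg (seq_mult A B)"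
  by (simp add: seq_mult_def seq_neg_def zip_map1 case_prod_unfold)

lemma seq_mult_neg_right: "seq_mult A (seq_neg B) = seq_neg (seq_mult A B)"
  by (simp add: seq_mult_def seq_neg_def zip_map2 case_prod_unfold)

text \<open>Each entry \<open>1\<close> adds one and every other entry takes one away; a zero sum
  therefore means that exactly half of the entries are \<open>1\<close>.\<close>

lemma sum_list_signs:
  "set Z \<subseteq> {1, -1} \<Longrightarrow> sum_list Z = 2 * int (seq_weight Z) - int (length Z)"
  by (induction Z) (auto simp: seq_weight_def)

lemma seq_weight_concat: "seq_weight (concat Zs) = (\<Sum>Z\<leftarrow>Zs. seq_weight Z)"
  by (induction Zs) (simp_all add: seq_weight_def)

lemma sum_list_seq_mult:
  "length A = length B \<Longrightarrow> sum_list (seq_mult A B) = (\<Sum>i<length A. A ! i * B ! i)"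
  by (simp add: seq_mult_def sum_list_sum_nth atLeast0LessThan)

text \<open>Row \<open>0\<close> of the circulant matrix is \<open>X\<close> and row
  \<open>k\<close> is \<open>rotate k X\<close>, so this sum is the entry at \<open>(0, k)\<close>
  of the matrix times its transpose, off the diagonal of a scalar matrix.\<close>

lemma hadamard_circulant_orthogonal_shift:
  assumes H: "hadamard_mat (length X) (circulant_mat X)" and k: "0 < k" "k < length X"
  shows "sum_list (seq_mult X (rotate k X)) = 0"
proof -
  let ?m = "length X" and ?A = "circulant_mat X"
  have "(?A * transpose_mat ?A) $$ (0, k) = (int ?m \<cdot>\<^sub>m 1\<^sub>m ?m) $$ (0, k)"
    using H by (simp add: hadamard_mat_def)
  moreover have "(?A * transpose_mat ?A) $$ (0, k) = (\<Sum>i<?m. X ! i * rotate k X ! i)"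
    using k order.strict_trans[OF k] by (auto simp: circulant_mat_def mat_of_rows_list_def scalar_prod_def
      atLeast0LessThan intro!: sum.cong)
  ultimately show ?thesis
    using k order.strict_trans[OF k] by (simp add: sum_list_seq_mult)
qed

text \<open>Adjacent blocks carry opposite signs, and this survives the wrap-around because the
  number of blocks is even: \<open>2 * r + 1\<close> is odd, so a block with that index has the sign
  of block \<open>1\<close>.\<close>

lemma seq_mult_block_shift:
  assumes r: "r \<ge> 1"
    and len: "\<And>i. 1 \<le> i \<Longrightarrow> i \<le> 2 * r + 1 \<Longrightarrow> length (Y i) = l"
    and wrap: "Y (2 * r + 1) = Y 1"
  shows "seq_mult (alternating_concat r Y) (rotate l (alternating_concat r Y)) =
    concat (map (\<lambda>i. seq_neg (seq_mult (Y i) (Y (Suc i)))) [1..<2 * r + 1])"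
proof -
  define B where "B i = (if odd i then Y i else seq_neg (Y i))" for i
  have lenB: "length (B i) = l" if "1 \<le> i" "i \<le> 2 * r + 1" for i
    using len[OF that] by (simp add: B_def seq_neg_def)
  have B_wrap: "B (2 * r + 1) = B 1"
    using wrap by (simp add: B_def)
  \<comment> \<open>As \<open>l\<close> is the length of the first block, the rotation moves that
    block whole to the end, where it is renamed to index \<open>2 * r + 1\<close>.\<close>
  have "rotate l (alternating_concat r Y) = rotate (length (B 1)) (B 1 @ concat (map B [2..<2 * r + 1]))"
    using r lenB[of 1]
    by (simp add: alternating_concat_def B_def[abs_def] upt_conv_Cons numeral_2_eq_2)
  also have "\<dots> = concat (map B [2..<2 * r + 1]) @ B (2 * r + 1)"
    unfolding B_wrap by (rule rotate_append)
  also have "\<dots> = concat (map B [Suc 1..<Suc (2 * r + 1)])"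
    using r by (simp add: numeral_2_eq_2)
  also have "\<dots> = concat (map (\<lambda>i. B (Suc i)) [1..<2 * r + 1])"
    by (simp only: map_Suc_upt[symmetric] map_map o_def)
  finally have "rotate l (alternating_concat r Y) = concat (map (\<lambda>i. B (Suc i)) [1..<2 * r + 1])" .
  moreover have "alternating_concat r Y = concat (map B [1..<2 * r + 1])"
    by (simp add: alternating_concat_def B_def[abs_def])
  ultimately have "seq_mult (alternating_concat r Y) (rotate l (alternating_concat r Y)) =
      concat (map (\<lambda>i. seq_mult (B i) (B (Suc i))) [1..<2 * r + 1])"
    using lenB by (simp only:, intro seq_mult_concat) auto
  \<comment> \<open>Exactly one of \<open>i\<close> and \<open>Suc i\<close> is even, so exactly one
    factor is negated.\<close>
  also have "(\<lambda>i. seq_mult (B i) (B (Suc i))) = (\<lambda>i. seq_neg (seq_mult (Y i) (Y (Suc i))))"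
    by (simp add: B_def fun_eq_iff seq_mult_neg_left seq_mult_neg_right)
  finally show ?thesis .
qed

theorem theorem15:
  fixes n r a :: nat and Y :: "nat \<Rightarrow> int list" and X :: "int list"
  assumes "n \<ge> 1" and "r \<ge> 1" and "a \<le> 2 * n" and "odd n"
    and "\<And>i. 1 \<le> i \<Longrightarrow> i \<le> 2 * r \<Longrightarrow> Y i \<in> sign_seqs_weight (2 * n) a"
    and "Y (2 * r + 1) = Y 1"
    and "X = alternating_concat r Y"
    and "(odd (n * r) \<and> rat_even (weight_sum r a Y)) \<or> (even (n * r) \<and> rat_odd (weight_sum r a Y))"
  shows "\<not> hadamard_mat (4 * r * n) (circulant_mat X)"
proof
  assume H: "hadamard_mat (4 * r * n) (circulant_mat X)"
  \<comment> \<open>The range includes \<open>2 * r + 1\<close> because the last product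
    \<open>P (2 * r)\<close> involves that block.\<close>
  have Y: "Y i \<in> sign_seqs (2 * n)" if "1 \<le> i" "i \<le> 2 * r + 1" for i
    using assms(5)[of i] assms(5)[of 1] assms(2,6) that
    by (cases "i = 2 * r + 1") (auto simp: sign_seqs_weight_def)
  define P where "P i = seq_neg (seq_mult (Y i) (Y (Suc i)))" for i
  define Z where "Z = concat (map P [1..<2 * r + 1])"
  have P: "P i \<in> sign_seqs (2 * n)" if "1 \<le> i" "i \<le> 2 * r" for i
    unfolding P_def using that by (intro seq_neg_sign_seqs seq_mult_sign_seqs Y) auto
  have Z: "seq_mult X (rotate (2 * n) X) = Z"
    unfolding Z_def P_def assms(7)
    using assms(2,6) Y by (intro seq_mult_block_shift) (auto simp: sign_seqs_def)
  \<comment> \<open>The length is read off from the number of rows of the Hadamard matrix.\<close>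
  have lenX: "length X = 4 * r * n"
  proof -
    have "dim_row (circulant_mat X) = 4 * r * n"
      using H unfolding hadamard_mat_def by (blast dest: carrier_matD)
    then show ?thesis
      by (simp add: circulant_mat_def mat_of_rows_list_def)
  qed
  have lenZ: "length Z = 4 * r * n"
    using lenX by (simp add: Z[symmetric] seq_mult_def)
  have "set (P i) \<subseteq> {1, -1}" if "i \<in> set [1..<2 * r + 1]" for i
    using P[of i] that by (auto simp: sign_seqs_def)
  then have "set Z \<subseteq> {1, -1}"
    unfolding Z_def set_concat set_map image_image by blast
  then have "sum_list Z = 2 * int (seq_weight Z) - int (4 * r * n)"
    unfolding lenZ[symmetric] by (rule sum_list_signs)
  moreover have "sum_list Z = 0"
    unfolding Z[symmetric]
  proof (rule hadamard_circulant_orthogonal_shift)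
    show "hadamard_mat (length X) (circulant_mat X)"
      unfolding lenX by (rule H)
    show "0 < 2 * n"
      using assms(1) by simp
    \<comment> \<open>There are at least two blocks, so a shift by one block reaches a row other
      than row \<open>0\<close>.\<close>
    have "2 * n * 1 < 2 * n * (2 * r)"
      using assms(1,2) by (intro mult_strict_left_mono) auto
    also have "\<dots> = length X"
      by (simp add: lenX)
    finally show "2 * n < length X"
      by (simp only: mult_1_right)
  qed
  ultimately have "int (seq_weight Z) = int (2 * r * n)"
    by simp
  then have "seq_weight Z = 2 * r * n"
    by (simp only: of_nat_eq_iff)
  moreover have "seq_weight Z = (\<Sum>i = 1..2 * r. seq_weight (P i))"
    unfolding Z_def seq_weight_concat map_map o_def sum_list_distinct_conv_sum_set[OF distinct_upt]
    by (rule sum.cong) auto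
  ultimately have "rat_of_nat (\<Sum>i = 1..2 * r. seq_weight (P i)) = of_nat (2 * r * n)"
    by (simp only:)
  then have "(\<Sum>i = 1..2 * r. rat_of_nat (seq_weight (P i))) = 2 * of_nat r * of_nat n"
    by simp
  \<comment> \<open>The halved weights add up to \<open>r * n\<close>, and the \<open>2 * r\<close>
    summands \<open>2 * a\<close> to \<open>4 * a * r\<close>.\<close>
  then have "weight_sum r a Y = of_int (4 * int a * int r - int (n * r))"
    by (simp add: weight_sum_def P_def sum_subtractf sum_divide_distrib[symmetric])
  \<comment> \<open>Injectivity of \<open>of_int\<close> leaves only this integer as witness for
    evenness or oddness, and its parity contradicts either alternative.\<close>
  with assms(8) show False
    unfolding rat_even_def rat_odd_def by (auto simp only: of_int_eq_iff) simp_all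
qed

end
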